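(* Let $\mathcal{R}$ be the set of all real numbers $r$ such that $\Phi_T(r)=0$ for some finite tree $T$. Then the closure of $\mathcal{R}$ in $\mathbb{R}$ contains the interval $[-2,-1]$.
   Context: For a finite tree $T$ of order $n$, $s_k(T)$ denotes the number of subtrees (connected induced subgraphs) of $T$ of order $k$, and the subtree polynomial of $T$ is $\Phi_T(x)=\sum_{k=1}^n s_k(T)x^k$. *)

theory Defs
  imports
    "HOL-Analysis.Analysis"
    "HOL-Computational_Algebra.Polynomial"
    "Graph_Theory.Digraph_Component"
begin

text \<open>
  Finite simple graphs are symmetric digraphs, as in locale \<^locale>\<open>graph\<close>: an edge
  is a pair of opposite arcs. An edge traversed back and forth is therefore a
  \<^const>\<open>pre_digraph.cycle\<close> of length 2, so that \<^const>\<open>forest\<close> and \<^const>\<open>tree\<close>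
  reject every graph with an edge. The cycles of the underlying simple graph are those of
  length at least 3. Nonemptiness of the vertex set is part of
  \<^const>\<open>Digraph_Component.connected\<close>.
\<close>

definition finite_tree :: "('a, 'b) pre_digraph \<Rightarrow> bool" where
  "finite_tree T \<longleftrightarrow> graph T \<and> Digraph_Component.connected T \<and>
     \<not> (\<exists>p. pre_digraph.cycle T p \<and> 3 \<le> length p)"

definition num_subtrees :: "('a, 'b) pre_digraph \<Rightarrow> nat \<Rightarrow> nat" where
  "num_subtrees T k =
     card {H. induced_subgraph H T \<and> Digraph_Component.connected H \<and> card (verts H) = k}"

definition subtree_poly :: "('a, 'b) pre_digraph \<Rightarrow> real poly" where
  "subtree_poly T = (\<Sum>k = 1..card (verts T). monom (real (num_subtrees T k)) k)"

text \<open>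
  Every finite tree is isomorphic to one whose vertices are natural numbers and whose arcs
  are pairs of vertices, so these types suffice to range over all finite trees.
\<close>

definition subtree_roots :: "real set" where
  "subtree_roots =
     {r. \<exists>T :: (nat, nat \<times> nat) pre_digraph. finite_tree T \<and> poly (subtree_poly T) r = 0}"

end

theory Submission
  imports Defs "HOL-Real_Asymp.Real_Asymp"
begin

text \<open>
  The spider with \<open>a\<close> legs of length two and \<open>b\<close> legs of length one has the subtree polynomial
  \<open>x ((1 + x + x\<^sup>2)\<^sup>a (1 + x)\<^sup>b + a (2 + x) + b)\<close>. Put \<open>x = -1 - t\<close> with \<open>0 < t < 1\<close> and let \<open>b\<close> be odd:
  the nonzero roots are the solutions of \<open>(1 + t + t\<^sup>2)\<^sup>a t\<^sup>b = a (1 - t) + b\<close>.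
  Since \<open>ln (1 + t + t\<^sup>2) / (- ln t)\<close> is strictly increasing, for \<open>c < d\<close> there is a ratio \<open>b / a\<close>
  strictly between its values at \<open>c\<close> and \<open>d\<close>. Scaling \<open>a\<close> and \<open>b\<close> up in this ratio, the left-hand side
  tends to \<open>0\<close> at \<open>c\<close> and grows exponentially at \<open>d\<close>, while the right-hand side grows linearly,
  so a solution lies between \<open>c\<close> and \<open>d\<close>.
\<close>

section \<open>Subtree polynomials as sums over connected vertex sets\<close>

text \<open>An induced subgraph is determined by its vertex set, and connected ones are nonempty, so
  grouping the sum by cardinality gives the coefficients.\<close>

lemma poly_subtree_poly:
  assumes "fin_digraph T"
  shows "poly (subtree_poly T) x =
    (\<Sum>S | S \<subseteq> verts T \<and> Digraph_Component.connected (T \<restriction> S). x ^ card S)"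
proof -
  interpret fin_digraph T by fact
  let ?C = "{S. S \<subseteq> verts T \<and> Digraph_Component.connected (T \<restriction> S)}"
  have fin: "finite ?C" by (rule finite_subset[of _ "Pow (verts T)"]) auto
  have num: "num_subtrees T k = card {S \<in> ?C. card S = k}" for k
  proof -
    have eq: "H = T \<restriction> verts H" if "induced_subgraph H T" for H
      using that by (auto simp: induced_subgraph_def subgraph_def compatible_def induce_subgraph_def)
    have "bij_betw verts
        {H. induced_subgraph H T \<and> Digraph_Component.connected H \<and> card (verts H) = k}
        {S \<in> ?C. card S = k}"
    proof (rule bij_betwI[where g = "induce_subgraph T"])
      show "verts \<in> {H. induced_subgraph H T \<and> Digraph_Component.connected H \<and> card (verts H) = k}
          \<rightarrow> {S \<in> ?C. card S = k}"
        using eq by (auto simp: induced_subgraph_def subgraph_def)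
    qed (use eq in auto)
    then show ?thesis by (simp add: num_subtrees_def bij_betw_same_card)
  qed
  have card: "card S \<in> {1..card (verts T)}" if "S \<in> ?C" for S
  proof -
    have "S \<noteq> {}" "finite S"
      using that by (auto simp: connected_conv intro: finite_subset[OF _ finite_verts])
    then show ?thesis
      using that by (auto simp: Suc_le_eq card_gt_0_iff intro: card_mono)
  qed
  have "poly (subtree_poly T) x = (\<Sum>k = 1..card (verts T). real (num_subtrees T k) * x ^ k)"
    by (simp add: subtree_poly_def poly_sum poly_monom)
  also have "\<dots> = (\<Sum>k = 1..card (verts T). \<Sum>S \<in> {S \<in> ?C. card S = k}. x ^ card S)"
    by (simp add: num)
  also have "\<dots> = (\<Sum>S \<in> ?C. x ^ card S)"
    using card by (intro sum.group[OF fin]) auto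
  finally show ?thesis .
qed

section \<open>Trees given by a parent function\<close>

definition parent_tree :: "nat \<Rightarrow> (nat \<Rightarrow> nat) \<Rightarrow> (nat, nat \<times> nat) pre_digraph" where
  "parent_tree n par = \<lparr>verts = {..<n},
     arcs = (\<Union>v\<in>{1..<n}. {(v, par v), (par v, v)}), tail = fst, head = snd\<rparr>"

lemma parent_tree_simps [simp]:
  "verts (parent_tree n par) = {..<n}"
  "arcs (parent_tree n par) = (\<Union>v\<in>{1..<n}. {(v, par v), (par v, v)})"
  "tail (parent_tree n par) = fst"
  "head (parent_tree n par) = snd"
  by (simp_all add: parent_tree_def)

text \<open>Vertex \<open>0\<close> is the root. Labels decrease towards it, so acyclicity and
  connectedness both follow by comparing labels.\<close>

locale parent_function =
  fixes n :: nat and par :: "nat \<Rightarrow> nat"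
  assumes pos: "0 < n" and par_less: "\<And>v. 0 < v \<Longrightarrow> v < n \<Longrightarrow> par v < v"
begin

abbreviation "T \<equiv> parent_tree n par"

lemma par_bound: "0 < v \<Longrightarrow> v < n \<Longrightarrow> par v < n"
  using par_less by (meson order.strict_trans)

lemma graph_parent_tree: "graph T"
proof
  show "tail T e \<in> verts T" "head T e \<in> verts T" "tail T e \<noteq> head T e" if "e \<in> arcs T" for e
    using that par_bound par_less by (auto, (metis Suc_le_eq less_irrefl)+)
  show "symmetric T"
    by (auto simp: symmetric_conv)
qed (auto simp: arc_to_ends_def prod_eq_iff)

lemma induced_edge_iff:
  assumes "S \<subseteq> {..<n}"
  shows "(u, v) \<in> (arcs_ends (T \<restriction> S))\<^sup>s \<longleftrightarrow>
    u \<in> S \<and> v \<in> S \<and> (0 < u \<and> v = par u \<or> 0 < v \<and> u = par v)"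
proof -
  have "w < n" if "w \<in> S" for w using assms that by blast
  then have "(u, v) \<in> arcs_ends (T \<restriction> S) \<longleftrightarrow>
      u \<in> S \<and> v \<in> S \<and> (0 < u \<and> v = par u \<or> 0 < v \<and> u = par v)" for u v
    by (auto simp: arcs_ends_conv image_iff Suc_le_eq)
  then show ?thesis by (auto simp: symcl_def)
qed

text \<open>Labels decrease along parents, so the top vertex of a connected set is its minimum, and
  every other member climbs to it without leaving the set.\<close>

lemma connected_induced_iff:
  assumes S: "S \<subseteq> {..<n}"
  shows "Digraph_Component.connected (T \<restriction> S) \<longleftrightarrow>
    S \<noteq> {} \<and> (\<forall>v\<in>S. v \<noteq> Min S \<longrightarrow> par v \<in> S)" (is "_ \<longleftrightarrow> ?R")
proof -
  let ?E = "(arcs_ends (T \<restriction> S))\<^sup>s"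
  have fin: "finite S" using S finite_subset by blast
  have "(u, v) \<in> rtrancl_on S ?E" if R: ?R and uv: "u \<in> S" "v \<in> S" for u v
  proof -
    have up: "(w, Min S) \<in> rtrancl_on S ?E" if "w \<in> S" for w
      using that
    proof (induction w rule: less_induct)
      case (less w)
      show ?case
      proof (cases "w = Min S")
        case True
        with less.prems show ?thesis by simp
      next
        case False
        then have "par w \<in> S" using R less.prems by blast
        moreover have "0 < w"
          using False Min_le[OF fin less.prems] by linarith
        moreover have "w < n" using S less.prems by blast
        ultimately have "(par w, Min S) \<in> rtrancl_on S ?E" "(w, par w) \<in> ?E"
          using less.IH par_less less.prems by (auto simp: induced_edge_iff[OF S])
        then show ?thesis
          using converse_rtrancl_on_into_rtrancl_on less.prems by metis
      qed
    qed
    have "sym (rtrancl_on S ?E)"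
      by (rule rtrancl_on_sym) (auto simp: sym_def induced_edge_iff[OF S])
    then show ?thesis using up uv by (meson rtrancl_on_trans symE)
  qed
  moreover have "par v \<in> S"
    if conn: "\<forall>u\<in>S. \<forall>v\<in>S. (u, v) \<in> rtrancl_on S ?E" and v: "v \<in> S" "v \<noteq> Min S" for v
  proof (rule ccontr)
    assume npar: "par v \<notin> S"
    \<comment> \<open>\<open>P\<close> links child to parent, so
      \<open>(y, v) \<in> P\<^sup>*\<close> makes \<open>y\<close> a descendant of \<open>v\<close>
      or \<open>v\<close> itself. For \<open>y = Min S\<close> this forces
      \<open>v \<le> Min S\<close>.\<close>
    define P where "P = {(w, par w) |w. 0 < w \<and> w < n}"
    have "(v, Min S) \<in> rtrancl_on S ?E" using conn v Min_in[OF fin] by blast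
    then have "(Min S, v) \<in> P\<^sup>*"
    \<comment> \<open>Inside \<open>S\<close>, a walk can leave the set of descendants of \<open>v\<close> only through \<open>par v\<close>.\<close>
    proof (induction rule: rtrancl_on_induct)
      case (step y z)
      then consider "0 < y" "z = par y" | "0 < z" "y = par z"
        using induced_edge_iff[OF S] by blast
      then show ?case
      proof cases
        case 1
        from step.IH show ?thesis
        proof (cases rule: converse_rtranclE)
          case base
          then show ?thesis using 1 npar step by (auto simp: induced_edge_iff[OF S])
        next
          case (step w)
          then show ?thesis using 1 by (auto simp: P_def)
        qed
      next
        case 2
        moreover have "z < n" using step S by (auto simp: induced_edge_iff[OF S])
        ultimately have "(z, y) \<in> P" by (auto simp: P_def)
        then show ?thesis using step by (meson converse_rtrancl_into_rtrancl)
      qed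
    qed simp
    moreover have "z \<le> y" if "(y, z) \<in> P\<^sup>*" for y z
      using that
    proof (induction rule: rtrancl_induct)
      case (step w z)
      then show ?case using par_less[of w] by (auto simp: P_def)
    qed simp
    ultimately have "v \<le> Min S" by blast
    then show False using v Min_le[OF fin v(1)] by simp
  qed
  ultimately show ?thesis
    by (auto simp: connected_conv)
qed

lemma no_long_cycle:
  assumes cyc: "pre_digraph.cycle T p" and len: "3 \<le> length p"
  shows False
proof -
  define k where "k = length p"
  obtain u where u: "pre_digraph.awalk T u p u" "distinct (tl (pre_digraph.awalk_verts T u p))" "p \<noteq> []"
    using cyc by (auto simp: pre_digraph.cycle_def)
  define f where "f i = pre_digraph.awalk_verts T u p ! i" for i
  have cas: "pre_digraph.cas T u p u" and arcs: "set p \<subseteq> arcs T"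
    using u(1) by (auto simp: pre_digraph.awalk_def)
  have tail: "f i = fst (p ! i)" if "i < k" for i
    using that u(3) by (simp add: f_def k_def pre_digraph.awalk_verts_conv nth_append)
  have head: "f (Suc i) = snd (p ! i)" if "i < k" for i
    using that u(3) by (simp add: f_def k_def pre_digraph.awalk_verts_conv'[OF cas])
  have adj: "0 < f i \<and> f i < n \<and> f (Suc i) = par (f i) \<or>
      0 < f (Suc i) \<and> f (Suc i) < n \<and> f i = par (f (Suc i))" if "i < k" for i
  proof -
    have "p ! i \<in> arcs T" using that arcs nth_mem unfolding k_def by blast
    moreover have "p ! i = (f i, f (Suc i))" using tail[OF that] head[OF that] by simp
    ultimately show ?thesis by auto
  qed
  have closed: "f 0 = f k"
  proof -
    have "f 0 = u"
      using u(3) cas tail[of 0] by (cases p) (auto simp: k_def pre_digraph.cas.simps)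
    moreover have "pre_digraph.cas T v q w \<Longrightarrow> q \<noteq> [] \<Longrightarrow> snd (last q) = w" for v q w
      by (induction q arbitrary: v) (auto simp: pre_digraph.cas.simps)
    then have "f k = u"
      using head[of "k - 1"] u(3) cas len by (auto simp: k_def last_conv_nth)
    ultimately show ?thesis by simp
  qed
  \<comment> \<open>Indices start at \<open>1\<close> because a cycle repeats its first vertex at
    the end: only the tail of its vertex list is distinct.\<close>
  have inj: "i = j" if "f i = f j" "i \<in> {1..k}" "j \<in> {1..k}" for i j
  proof -
    have "length (tl (pre_digraph.awalk_verts T u p)) = k"
      by (simp add: pre_digraph.length_awalk_verts k_def)
    moreover have "f i = tl (pre_digraph.awalk_verts T u p) ! (i - 1)"
        "f j = tl (pre_digraph.awalk_verts T u p) ! (j - 1)"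
      using that calculation by (auto simp: f_def nth_tl)
    moreover have "i - 1 < k" "j - 1 < k" using that(2,3) by auto
    ultimately have "i - 1 = j - 1"
      using u(2) that(1) by (metis nth_eq_iff_index_eq)
    then show ?thesis using that by auto
  qed
  have k: "3 \<le> k" using len by (simp add: k_def)
  \<comment> \<open>Both neighbours on the cycle of its largest vertex are the parent of that vertex.\<close>
  have "Max (f ` {1..k}) \<in> f ` {1..k}"
    using k by (intro Max_in) auto
  then obtain i where i: "i \<in> {1..k}" "Max (f ` {1..k}) = f i" by blast
  have max: "f j \<le> f i" if "j \<in> {1..k}" for j
    using that i(2) by (metis Max_ge finite_atLeastAtMost finite_imageI imageI)
  \<comment> \<open>Cyclic predecessor and successor of \<open>i\<close>, kept inside
    \<open>{1..k}\<close> where \<open>f\<close> is injective; \<open>f 0 = f k\<close> handles the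
    wrap-around. They coincide only if \<open>k \<le> 2\<close>.\<close>
  define l where "l = (if i = 1 then k else i - 1)"
  define r where "r = (if i = k then 1 else Suc i)"
  have lr: "l \<in> {1..k}" "r \<in> {1..k}" using i k by (auto simp: l_def r_def)
  have "f l = f (i - 1)" using closed by (auto simp: l_def)
  then have "f l = par (f i)"
    using adj[of "i - 1"] max[OF lr(1)] i par_less[of "f l"] by fastforce
  moreover have "f r = par (f i)"
    using adj[of "i mod k"] max[OF lr(2)] i k par_less[of "f r"] closed
    by (cases "i = k") (fastforce simp: r_def)+
  ultimately have "l = r" using inj lr by metis
  then show False using i k by (auto simp: l_def r_def split: if_splits)
qed

lemma finite_tree_parent_tree: "finite_tree T"
proof -
  have "T \<restriction> {..<n} = T"
    using par_bound by (auto simp: induce_subgraph_def parent_tree_def)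
  moreover have "Min {..<n} = 0"
    using pos by (intro Min_eqI) auto
  ultimately have "Digraph_Component.connected T"
    using connected_induced_iff[of "{..<n}"] pos par_bound by auto
  then show ?thesis
    using graph_parent_tree no_long_cycle by (auto simp: finite_tree_def)
qed

end

section \<open>Spiders with legs of length one and two\<close>

text \<open>Label \<open>0\<close> is the centre, \<open>1..a\<close> are the inner vertices of the
  long legs, \<open>a + v\<close> is the leaf beyond \<open>v\<close>, and labels above
  \<open>2 * a\<close> are the short legs. The centre is its own parent, so parent-closure can be
  required of every vertex of a set containing \<open>0\<close>.\<close>

definition spider_parent :: "nat \<Rightarrow> nat \<Rightarrow> nat" where
  "spider_parent a v = (if a < v \<and> v \<le> 2 * a then v - a else 0)"

abbreviation spider :: "nat \<Rightarrow> nat \<Rightarrow> (nat, nat \<times> nat) pre_digraph" where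
  "spider a b \<equiv> parent_tree (2 * a + b + 1) (spider_parent a)"

lemma parent_function_spider: "parent_function (2 * a + b + 1) (spider_parent a)"
  by unfold_locales (auto simp: spider_parent_def)

lemma sum_power_card_Pow:
  fixes x :: "'a :: comm_semiring_1"
  assumes "finite A"
  shows "(\<Sum>B\<in>Pow A. x ^ card B) = (1 + x) ^ card A"
  using prod_add[OF assms, of "\<lambda>_. x" "\<lambda>_. 1"] by (simp add: add.commute)

text \<open>Once the centre is chosen the legs are independent: a long leg contributes
  \<open>1 + x + x * x\<close>, a short one \<open>1 + x\<close>.\<close>

lemma sum_rooted_spider:
  fixes x :: "'a :: comm_semiring_1"
  shows "(\<Sum>S | S \<subseteq> {..<2 * a + b + 1} \<and> 0 \<in> S \<and> (\<forall>v\<in>S. spider_parent a v \<in> S). x ^ card S)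
    = x * (1 + x * (1 + x)) ^ a * (1 + x) ^ b" (is "sum _ ?R = _")
proof -
  \<comment> \<open>The leaves available once the inner vertices \<open>B\<close> are chosen: those
    beyond \<open>B\<close>, and all short legs.\<close>
  define L where "L B = (+) a ` B \<union> {2 * a + 1..<2 * a + b + 1}" for B
  have card_L: "card (L B) = card B + b" "finite (L B)" if "B \<subseteq> {1..a}" for B
  proof -
    have "finite B" using that finite_subset by blast
    then show "finite (L B)" by (simp add: L_def)
    have "(+) a ` B \<inter> {2 * a + 1..<2 * a + b + 1} = {}" using that by fastforce
    then show "card (L B) = card B + b"
      using \<open>finite B\<close> by (simp add: L_def card_Un_disjoint card_image)
  qed
  have bij: "bij_betw (\<lambda>(B, E). insert 0 (B \<union> E)) (SIGMA B:Pow {1..a}. Pow (L B)) ?R"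
  proof (rule bij_betwI[where g = "\<lambda>S. (S \<inter> {1..a}, S \<inter> {a<..})"])
    show "(\<lambda>(B, E). insert 0 (B \<union> E)) \<in> (SIGMA B:Pow {1..a}. Pow (L B)) \<rightarrow> ?R"
      by (fastforce simp: L_def spider_parent_def)
  next
    show "(\<lambda>S. (S \<inter> {1..a}, S \<inter> {a<..})) \<in> ?R \<rightarrow> (SIGMA B:Pow {1..a}. Pow (L B))"
    proof clarsimp
      fix S v assume S: "S \<subseteq> {..<Suc (2 * a + b)}" "\<forall>v\<in>S. spider_parent a v \<in> S"
        and v: "v \<in> S" "a < v"
      show "v \<in> L (S \<inter> {Suc 0..a})"
      proof (cases "v \<le> 2 * a")
        case True
        then have "v - a \<in> S \<inter> {Suc 0..a}" using S(2) v by (force simp: spider_parent_def)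
        moreover have "v = a + (v - a)" using v by simp
        ultimately show ?thesis unfolding L_def by blast
      qed (use S v in \<open>auto simp: L_def\<close>)
    qed
  next
    fix BE assume "BE \<in> (SIGMA B:Pow {1..a}. Pow (L B))"
    then obtain B E where BE: "BE = (B, E)" "B \<subseteq> {1..a}" "E \<subseteq> L B" by auto
    then have "E \<subseteq> {a<..}" by (fastforce simp: L_def)
    then have "insert 0 (B \<union> E) \<inter> {1..a} = B" "insert 0 (B \<union> E) \<inter> {a<..} = E"
      using BE(2) by fastforce+
    then show "(\<lambda>S. (S \<inter> {1..a}, S \<inter> {a<..})) ((\<lambda>(B, E). insert 0 (B \<union> E)) BE) = BE"
      by (simp add: BE(1))
  qed auto
  have card: "card (insert 0 (B \<union> E)) = 1 + card B + card E" if "B \<subseteq> {1..a}" "E \<subseteq> L B" for B E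
  proof -
    have "finite B" "finite E" using that card_L(2) finite_subset by blast+
    moreover have "E \<subseteq> {a<..}" using that by (fastforce simp: L_def)
    then have "0 \<notin> B \<union> E" "B \<inter> E = {}" using that(1) by fastforce+
    ultimately show ?thesis by (simp add: card_Un_disjoint)
  qed
  have "(\<Sum>S\<in>?R. x ^ card S) =
      (\<Sum>(B, E)\<in>(SIGMA B:Pow {1..a}. Pow (L B)). x ^ (1 + card B + card E))"
    using card by (subst sum.reindex_bij_betw[OF bij, symmetric]) (auto intro!: sum.cong)
  also have "\<dots> = (\<Sum>B\<in>Pow {1..a}. x ^ (1 + card B) * (\<Sum>E\<in>Pow (L B). x ^ card E))"
    using card_L(2) by (subst sum.Sigma[symmetric]) (auto simp: power_add sum_distrib_left mult_ac)
  also have "\<dots> = (\<Sum>B\<in>Pow {1..a}. x * (1 + x) ^ b * (x * (1 + x)) ^ card B)"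
    by (rule sum.cong) (simp_all add: sum_power_card_Pow card_L power_add power_mult_distrib mult_ac)
  also have "\<dots> = x * (1 + x) ^ b * (1 + x * (1 + x)) ^ a"
    by (simp flip: sum_distrib_left add: sum_power_card_Pow)
  finally show ?thesis by (simp add: mult_ac)
qed

text \<open>A subtree avoiding the centre lies within one leg, so it is a single vertex or a whole
  long leg.\<close>

lemma unrooted_spider_sets:
  "{S. S \<subseteq> {..<2 * a + b + 1} \<and> S \<noteq> {} \<and> 0 \<notin> S \<and>
      (\<forall>v\<in>S. v \<noteq> Min S \<longrightarrow> spider_parent a v \<in> S)}
    = (\<lambda>v. {v}) ` {1..<2 * a + b + 1} \<union> (\<lambda>v. {v, a + v}) ` {1..a}" (is "?L = ?R")
proof
  show "?L \<subseteq> ?R"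
  proof
    fix S assume "S \<in> ?L"
    then have S: "S \<subseteq> {..<2 * a + b + 1}" "S \<noteq> {}" "0 \<notin> S"
      and par: "\<And>v. v \<in> S \<Longrightarrow> v \<noteq> Min S \<Longrightarrow> spider_parent a v \<in> S" by auto
    have fin: "finite S" using S(1) finite_subset by blast
    define m where "m = Min S"
    have m: "m \<in> S" "0 < m" using S fin Min_in[OF fin S(2)] by (auto simp: m_def intro: ccontr)
    have other: "v = a + m \<and> m \<le> a" if v: "v \<in> S" "v \<noteq> m" for v
    proof -
      have p: "spider_parent a v \<in> S" using par v by (simp add: m_def)
      then have va: "a < v" "v \<le> 2 * a" "v - a \<in> S"
        using S(3) by (auto simp: spider_parent_def split: if_splits)
      \<comment> \<open>The parent of this inner vertex is the excluded centre, so the vertex can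
        only be the minimum of \<open>S\<close>.\<close>
      moreover have "spider_parent a (v - a) = 0" using va by (simp add: spider_parent_def)
      then have "v - a = m" using par[OF va(3)] S(3) by (auto simp: m_def)
      ultimately show ?thesis by auto
    qed
    show "S \<in> ?R"
    proof (cases "S = {m}")
      case True
      then show ?thesis using m S(1) by auto
    next
      case False
      then have "S = {m, a + m}" "m \<le> a" using other m by blast+
      then show ?thesis using m by auto
    qed
  qed
  show "?R \<subseteq> ?L"
    by (auto simp: spider_parent_def)
qed

text \<open>Subtrees avoiding the centre add \<open>(2 * a + b) * x\<close> for single vertices and
  \<open>a * x^2\<close> for whole long legs.\<close>

lemma poly_subtree_poly_spider:
  "poly (subtree_poly (spider a b)) x =
    x * ((1 + x * (1 + x)) ^ a * (1 + x) ^ b + real a * (2 + x) + real b)"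
proof -
  let ?n = "2 * a + b + 1"
  interpret parent_function ?n "spider_parent a" by (rule parent_function_spider)
  let ?C = "{S. S \<subseteq> {..<?n} \<and> S \<noteq> {} \<and> (\<forall>v\<in>S. v \<noteq> Min S \<longrightarrow> spider_parent a v \<in> S)}"
  let ?R = "{S. S \<subseteq> {..<?n} \<and> 0 \<in> S \<and> (\<forall>v\<in>S. spider_parent a v \<in> S)}"
  let ?U = "{S. S \<subseteq> {..<?n} \<and> S \<noteq> {} \<and> 0 \<notin> S \<and>
      (\<forall>v\<in>S. v \<noteq> Min S \<longrightarrow> spider_parent a v \<in> S)}"
  have min: "Min S = 0" if "S \<subseteq> {..<?n}" "0 \<in> S" for S
    using that finite_subset by (intro Min_eqI) auto
  have "fin_digraph (spider a b)"
    using graph_parent_tree by (simp add: graph_def digraph_def)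
  then have "poly (subtree_poly (spider a b)) x =
      (\<Sum>S | S \<subseteq> {..<?n} \<and> Digraph_Component.connected (spider a b \<restriction> S). x ^ card S)"
    by (simp add: poly_subtree_poly)
  also have "\<dots> = (\<Sum>S\<in>?C. x ^ card S)"
    using connected_induced_iff by (intro sum.cong) auto
  also have "?C = ?R \<union> ?U"
    using min by (auto simp: spider_parent_def)
  also have "(\<Sum>S\<in>?R \<union> ?U. x ^ card S) = (\<Sum>S\<in>?R. x ^ card S) + (\<Sum>S\<in>?U. x ^ card S)"
    by (rule sum.union_disjoint) (auto intro: finite_subset[of _ "Pow {..<?n}"])
  also have "(\<Sum>S\<in>?U. x ^ card S) =
      (\<Sum>S\<in>(\<lambda>v. {v}) ` {1..<?n}. x ^ card S) + (\<Sum>S\<in>(\<lambda>v. {v, a + v}) ` {1..a}. x ^ card S)"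
    unfolding unrooted_spider_sets by (rule sum.union_disjoint) auto
  also have "(\<Sum>S\<in>(\<lambda>v. {v}) ` {1..<?n}. x ^ card S) = real (2 * a + b) * x"
    by (subst sum.reindex) (auto simp: inj_on_def)
  also have "(\<Sum>S\<in>(\<lambda>v. {v, a + v}) ` {1..a}. x ^ card S) = (\<Sum>v\<in>{1..a}. x ^ 2)"
    by (subst sum.reindex) (auto simp: inj_on_def doubleton_eq_iff card_insert_if power2_eq_square intro!: sum.cong)
  finally show ?thesis
    unfolding sum_rooted_spider by (simp add: algebra_simps power2_eq_square)
qed

section \<open>Density of the roots\<close>

text \<open>After taking logarithms, the two inequalities say that \<open>m / n\<close> lies
  strictly between \<open>p c / q c\<close> and \<open>p d / q d\<close>; these differ because
  \<open>p\<close> increases and \<open>q\<close> decreases.\<close>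

lemma exists_balanced_exponents:
  fixes c d :: real
  assumes cd: "0 < c" "c < d" "d < 1"
  obtains m n :: nat where "(1 + c + c\<^sup>2) ^ n * c ^ m < 1" "1 < (1 + d + d\<^sup>2) ^ n * d ^ m"
proof -
  define p where "p t = ln (1 + t + t\<^sup>2)" for t :: real
  define q where "q t = - ln t" for t :: real
  have pq: "0 < p c" "p c < p d" "0 < q d" "q d < q c"
    using cd by (auto simp: p_def q_def add_pos_pos intro!: ln_gt_zero add_strict_mono power_strict_mono)
  then have "p c / q c < p d / q d" by (intro frac_less) auto
  then obtain r where r: "r \<in> \<rat>" "p c / q c < r" "r < p d / q d"
    using Rats_dense_in_real by blast
  have "0 < r" using r(2) pq by (smt (verit) divide_pos_pos)
  then obtain m n :: nat where mn: "n \<noteq> 0" "r = real m / real n"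
    using r(1) by (metis Rats_abs_nat_div_natE abs_of_pos)
  have pos: "0 < 1 + t + t\<^sup>2" if "0 < t" for t :: real
    using that by (simp add: add_pos_pos)
  have ln: "ln ((1 + t + t\<^sup>2) ^ n * t ^ m) = real n * p t - real m * q t" if "0 < t" for t
    using that pos[OF that] by (simp add: ln_mult ln_realpow p_def q_def)
  have "real n * p c - real m * q c < 0" "0 < real n * p d - real m * q d"
    using r mn pq by (auto simp: field_simps)
  then have lns: "ln ((1 + c + c\<^sup>2) ^ n * c ^ m) < 0" "0 < ln ((1 + d + d\<^sup>2) ^ n * d ^ m)"
    using ln cd by simp_all
  have "0 < (1 + t + t\<^sup>2) ^ n * t ^ m" if "0 < t" for t :: real
    using that pos by simp
  then have "0 < (1 + c + c\<^sup>2) ^ n * c ^ m" "0 < (1 + d + d\<^sup>2) ^ n * d ^ m"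
    using cd by simp_all
  with lns show ?thesis
    by (intro that[of n m]) (simp_all only: ln_less_zero_iff ln_gt_zero_iff)
qed

lemma exists_spider_equation_solution:
  fixes c d :: real
  assumes cd: "0 < c" "c < d" "d < 1"
  obtains a b :: nat and t where "odd b" "c \<le> t" "t \<le> d"
    "(1 + t + t\<^sup>2) ^ a * t ^ b = real a * (1 - t) + real b"
proof -
  obtain m n where c: "(1 + c + c\<^sup>2) ^ n * c ^ m < 1" and d: "1 < (1 + d + d\<^sup>2) ^ n * d ^ m"
    using exists_balanced_exponents[OF cd] by blast
  \<comment> \<open>The growth factor at \<open>d\<close> per unit of \<open>N\<close>. It is
    squared because the exponents are doubled below, which makes \<open>b = 2 * m * N + 1\<close>
    odd.\<close>
  define w where "w = ((1 + d + d\<^sup>2) ^ n * d ^ m)\<^sup>2"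
  have w: "1 < w" using d by (simp add: w_def one_less_power)
  have "eventually (\<lambda>N. real (2 * n * N) * (1 - d) + real (2 * m * N + 1) < w ^ N * d) sequentially"
    using w cd by real_asymp
  then obtain N where N: "real (2 * n * N) * (1 - d) + real (2 * m * N + 1) < w ^ N * d"
    by (auto simp: eventually_sequentially)
  define a where "a = 2 * n * N"
  define b where "b = 2 * m * N + 1"
  define h where "h t = (1 + t + t\<^sup>2) ^ a * t ^ b - (real a * (1 - t) + real b)" for t :: real
  have split: "(1 + t + t\<^sup>2) ^ a * t ^ b = (((1 + t + t\<^sup>2) ^ n * t ^ m)\<^sup>2) ^ N * t" for t :: real
    by (simp add: a_def b_def power_mult_distrib flip: power_mult) (simp add: mult_ac)
  \<comment> \<open>At \<open>c\<close> the base is below \<open>1\<close>, so the left-hand side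
    stays at most \<open>c\<close>, which is less than \<open>1 \<le> b\<close>.\<close>
  have "(((1 + c + c\<^sup>2) ^ n * c ^ m)\<^sup>2) ^ N * c \<le> 1 * c"
    using c cd by (intro mult_right_mono power_le_one) (auto simp: add_pos_pos intro!: mult_nonneg_nonneg)
  also have "\<dots> \<le> real b" using cd by (simp add: b_def add_increasing2)
  also have "\<dots> \<le> real a * (1 - c) + real b" using cd by simp
  finally have "h c \<le> 0" by (simp add: h_def split)
  moreover have "0 \<le> h d" using N unfolding h_def split by (simp add: a_def b_def w_def)
  moreover have "continuous_on {c..d} h" by (auto simp: h_def intro!: continuous_intros)
  ultimately obtain t where "c \<le> t" "t \<le> d" "h t = 0"
    using IVT'[of h c 0 d] cd by auto
  then show ?thesis using that[of b t a] by (simp add: h_def b_def)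
qed

theorem theorem3p4:
  shows "{-2..-1} \<subseteq> closure subtree_roots"
proof -
  \<comment> \<open>The open interval suffices, since its closure is the closed one; here
    \<open>- 1 - r\<close> lies strictly between \<open>0\<close> and \<open>1\<close>.\<close>
  have "{-2<..<-1} \<subseteq> closure subtree_roots"
  proof
    fix r :: real assume r: "r \<in> {-2<..<-1}"
    show "r \<in> closure subtree_roots"
      unfolding closure_approachable
    proof (intro allI impI)
      fix e :: real assume e: "0 < e"
      define c where "c = - 1 - r"
      \<comment> \<open>The first bound keeps \<open>- 1 - t\<close> within \<open>e / 2\<close> of
        \<open>r\<close>; the second, a midpoint, keeps \<open>d\<close> below
        \<open>1\<close>.\<close>
      define d where "d = min (c + e / 2) ((c + 1) / 2)"
      have cd: "0 < c" "c < d" "d < 1" using r e by (auto simp: c_def d_def min_def field_simps)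
      obtain a b :: nat and t where t: "odd b" "c \<le> t" "t \<le> d"
        "(1 + t + t\<^sup>2) ^ a * t ^ b = real a * (1 - t) + real b"
        using exists_spider_equation_solution[OF cd] by blast
      \<comment> \<open>For \<open>x = - 1 - t\<close> one has
        \<open>x * (1 + x) = t + t\<^sup>2\<close> and \<open>1 + x = - t\<close>; the sign comes
        from \<open>b\<close> being odd.\<close>
      have "(1 + (- 1 - t) * (1 + (- 1 - t))) ^ a * (1 + (- 1 - t)) ^ b = - ((1 + t + t\<^sup>2) ^ a * t ^ b)"
        using t(1) by (simp add: algebra_simps power2_eq_square)
      then have "poly (subtree_poly (spider a b)) (- 1 - t) = 0"
        unfolding poly_subtree_poly_spider t(4) by (simp add: algebra_simps)
      moreover have "finite_tree (spider a b)"
        by (rule parent_function.finite_tree_parent_tree[OF parent_function_spider])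
      ultimately have "- 1 - t \<in> subtree_roots"
        unfolding subtree_roots_def by blast
      moreover have "dist (- 1 - t) r < e"
        using t(2,3) e by (auto simp: dist_real_def c_def d_def)
      ultimately show "\<exists>y\<in>subtree_roots. dist y r < e" by blast
    qed
  qed
  then have "closure {-2<..<-1} \<subseteq> closure subtree_roots"
    using closure_minimal by blast
  then show ?thesis by simp
qed

end
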